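(* Let $\mathcal{H}$ be a Hopf algebra, $\cdot:\mathcal{H}\otimes R\to R$ a partial action of $\mathcal{H}$ on an algebra $R$, $g\in G(\mathcal{H})$, and $x\in\mathcal{H}$ with $\Delta(x)=x\otimes1+g\otimes x$, such that $gx=q^{-1}xg$ for some $q\in\Bbbk^\times$. If $g\cdot1_R=0$, then $$x^ja\cdot r=\sum_{k=0}^{j}(-1)^kq^{-\frac{k(k-1)}{2}}\binom{j}{k}_{q^{-1}}(x\cdot1_R)^{j-k}(g^ka\cdot r)(x\cdot1_R)^k$$ for all $a\in\mathcal{H}$, $r\in R$ and $j\in\mathbb{N}_0$.
   Context: $\Bbbk$ is an algebraically closed field of characteristic zero; all algebras are associative unital $\Bbbk$-algebras. Sweedler notation $\Delta(h)=h_1\otimes h_2$ is used; $G(\mathcal{H})$ is the group of grouplike elements of $\mathcal{H}$. A (left) partial action of a Hopf algebra $\mathcal{H}$ on an algebra $R$ is a linear map $\cdot:\mathcal{H}\otimes R\to R$, $h\otimes r\mapsto h\cdot r$, such that for all $h,k\in\mathcal{H}$, $r,s\in R$: (PA.1) $1_{\mathcal H}\cdot r=r$; (PA.2) $h\cdot (rs)=(h_1\cdot r)(h_2\cdot s)$; (PA.3) $h\cdot(k\cdot r)=(h_1\cdot 1_R)(h_2k\cdot r)$. $q$-binomial coefficients: $\binom{0}{0}_q=1$, $\binom{n}{m}_q=0$ if $m>n$ or $m<0$, and $\binom{n}{m}_q=\binom{n-1}{m}_q+q^{n-m}\binom{n-1}{m-1}_q$ for $n\ge1$, $0\le m\le n$.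 *)

theory Defs
  imports "HOL-Library.Poly_Mapping" "HOL-Computational_Algebra.Polynomial"
begin

section \<open>Tensor products of vector spaces\<close>

text \<open>
  The free vector space on a type \<open>'x\<close> is \<open>'x \<Rightarrow>\<^sub>0 'k\<close>.  The tensor product of two (three) spaces is
  its quotient, for \<open>'x\<close> the type of pairs (triples), by the span of the multilinearity relations;
  tensors are equivalence classes.
\<close>

definition formal_scale :: "'k::field \<Rightarrow> ('x \<Rightarrow>\<^sub>0 'k) \<Rightarrow> ('x \<Rightarrow>\<^sub>0 'k)" where
  "formal_scale c u = Poly_Mapping.map ((*) c) u"

definition lin_ext ::
    "('k::field \<Rightarrow> 'z \<Rightarrow> 'z::ab_group_add) \<Rightarrow> ('x \<Rightarrow> 'z) \<Rightarrow> ('x \<Rightarrow>\<^sub>0 'k) \<Rightarrow> 'z" where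
  "lin_ext scale f u =
     (\<Sum>p\<in>Poly_Mapping.keys u. scale (Poly_Mapping.lookup u p) (f p))"

text \<open>Here \<open>slot a\<close> is a pair or triple with \<open>a\<close> in one position and the other entries fixed.\<close>

definition slot_relations ::
    "('k::field \<Rightarrow> 'v \<Rightarrow> 'v::ab_group_add) \<Rightarrow> ('v \<Rightarrow> 'x) \<Rightarrow> ('x \<Rightarrow>\<^sub>0 'k) set" where
  "slot_relations scale slot =
     {Poly_Mapping.single (slot (a + b)) 1
        - Poly_Mapping.single (slot a) 1 - Poly_Mapping.single (slot b) 1 | a b. True}
     \<union> {Poly_Mapping.single (slot (scale c a)) 1 - Poly_Mapping.single (slot a) c | c a. True}"

definition tensor_null ::
    "('k::field \<Rightarrow> 'v \<Rightarrow> 'v::ab_group_add) \<Rightarrow> ('k \<Rightarrow> 'w \<Rightarrow> 'w::ab_group_add)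
     \<Rightarrow> ('v \<times> 'w \<Rightarrow>\<^sub>0 'k) set" where
  "tensor_null sV sW = module.span formal_scale
     ((\<Union>w. slot_relations sV (\<lambda>v. (v, w))) \<union> (\<Union>v. slot_relations sW (\<lambda>w. (v, w))))"

definition tensor3_null ::
    "('k::field \<Rightarrow> 'u \<Rightarrow> 'u::ab_group_add) \<Rightarrow> ('k \<Rightarrow> 'v \<Rightarrow> 'v::ab_group_add)
     \<Rightarrow> ('k \<Rightarrow> 'w \<Rightarrow> 'w::ab_group_add) \<Rightarrow> ('u \<times> 'v \<times> 'w \<Rightarrow>\<^sub>0 'k) set" where
  "tensor3_null sU sV sW = module.span formal_scale
     ((\<Union>v w. slot_relations sU (\<lambda>u. (u, v, w)))
      \<union> (\<Union>u w. slot_relations sV (\<lambda>v. (u, v, w)))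
      \<union> (\<Union>u v. slot_relations sW (\<lambda>w. (u, v, w))))"

definition tensor_rel ::
    "('k::field \<Rightarrow> 'v \<Rightarrow> 'v::ab_group_add) \<Rightarrow> ('k \<Rightarrow> 'w \<Rightarrow> 'w::ab_group_add)
     \<Rightarrow> ('v \<times> 'w \<Rightarrow>\<^sub>0 'k) rel" where
  "tensor_rel sV sW = {(s, t). s - t \<in> tensor_null sV sW}"

definition tensor3_rel ::
    "('k::field \<Rightarrow> 'u \<Rightarrow> 'u::ab_group_add) \<Rightarrow> ('k \<Rightarrow> 'v \<Rightarrow> 'v::ab_group_add)
     \<Rightarrow> ('k \<Rightarrow> 'w \<Rightarrow> 'w::ab_group_add) \<Rightarrow> ('u \<times> 'v \<times> 'w \<Rightarrow>\<^sub>0 'k) rel" where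
  "tensor3_rel sU sV sW = {(s, t). s - t \<in> tensor3_null sU sV sW}"

definition tensor_space ::
    "('k::field \<Rightarrow> 'v \<Rightarrow> 'v::ab_group_add) \<Rightarrow> ('k \<Rightarrow> 'w \<Rightarrow> 'w::ab_group_add)
     \<Rightarrow> ('v \<times> 'w \<Rightarrow>\<^sub>0 'k) set set" where
  "tensor_space sV sW = UNIV // tensor_rel sV sW"

definition tensor_class ::
    "('k::field \<Rightarrow> 'v \<Rightarrow> 'v::ab_group_add) \<Rightarrow> ('k \<Rightarrow> 'w \<Rightarrow> 'w::ab_group_add)
     \<Rightarrow> ('v \<times> 'w \<Rightarrow>\<^sub>0 'k) \<Rightarrow> ('v \<times> 'w \<Rightarrow>\<^sub>0 'k) set" where
  "tensor_class sV sW u = tensor_rel sV sW `` {u}"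

definition tensor3_class ::
    "('k::field \<Rightarrow> 'u \<Rightarrow> 'u::ab_group_add) \<Rightarrow> ('k \<Rightarrow> 'v \<Rightarrow> 'v::ab_group_add)
     \<Rightarrow> ('k \<Rightarrow> 'w \<Rightarrow> 'w::ab_group_add)
     \<Rightarrow> ('u \<times> 'v \<times> 'w \<Rightarrow>\<^sub>0 'k) \<Rightarrow> ('u \<times> 'v \<times> 'w \<Rightarrow>\<^sub>0 'k) set" where
  "tensor3_class sU sV sW u = tensor3_rel sU sV sW `` {u}"

definition tensor_rep :: "('v \<times> 'w \<Rightarrow>\<^sub>0 'k::field) set \<Rightarrow> ('v \<times> 'w \<Rightarrow>\<^sub>0 'k)" where
  "tensor_rep t = (SOME u. u \<in> t)"

text \<open>The elementary tensor of \<open>v\<close> and \<open>w\<close>, and the vector space operations on tensors.\<close>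

definition tensor ::
    "('k::field \<Rightarrow> 'v \<Rightarrow> 'v::ab_group_add) \<Rightarrow> ('k \<Rightarrow> 'w \<Rightarrow> 'w::ab_group_add)
     \<Rightarrow> 'v \<Rightarrow> 'w \<Rightarrow> ('v \<times> 'w \<Rightarrow>\<^sub>0 'k) set" where
  "tensor sV sW v w = tensor_class sV sW (Poly_Mapping.single (v, w) 1)"

definition tensor_add ::
    "('k::field \<Rightarrow> 'v \<Rightarrow> 'v::ab_group_add) \<Rightarrow> ('k \<Rightarrow> 'w \<Rightarrow> 'w::ab_group_add)
     \<Rightarrow> ('v \<times> 'w \<Rightarrow>\<^sub>0 'k) set \<Rightarrow> ('v \<times> 'w \<Rightarrow>\<^sub>0 'k) set \<Rightarrow> ('v \<times> 'w \<Rightarrow>\<^sub>0 'k) set" where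
  "tensor_add sV sW s t = tensor_class sV sW (tensor_rep s + tensor_rep t)"

definition tensor_scale ::
    "('k::field \<Rightarrow> 'v \<Rightarrow> 'v::ab_group_add) \<Rightarrow> ('k \<Rightarrow> 'w \<Rightarrow> 'w::ab_group_add)
     \<Rightarrow> 'k \<Rightarrow> ('v \<times> 'w \<Rightarrow>\<^sub>0 'k) set \<Rightarrow> ('v \<times> 'w \<Rightarrow>\<^sub>0 'k) set" where
  "tensor_scale sV sW c t = tensor_class sV sW (formal_scale c (tensor_rep t))"

text \<open>
  For bilinear \<open>f\<close>, \<open>tensor_lift sZ f\<close> is the linear map into \<open>'z\<close> induced by \<open>f\<close>; lemma
  \<open>tensor_lift_class\<close> below shows that the chosen representative does not matter.  With \<open>t = \<Delta> h\<close>
  it expresses Sweedler notation: \<open>tensor_lift sZ f (\<Delta> h)\<close> is \<open>f h\<^sub>1 h\<^sub>2\<close>.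
  Where \<open>sZ\<close> is \<open>formal_scale\<close>, \<open>f\<close> is bilinear only modulo the relations of a tensor product, and
  the result is meaningful only modulo these: it always occurs below \<open>tensor_class\<close> or
  \<open>tensor3_class\<close> (cf. \<open>tensor_mult_class\<close>).
\<close>

definition tensor_lift ::
    "('k::field \<Rightarrow> 'z \<Rightarrow> 'z::ab_group_add) \<Rightarrow> ('v \<Rightarrow> 'w \<Rightarrow> 'z) \<Rightarrow> ('v \<times> 'w \<Rightarrow>\<^sub>0 'k) set \<Rightarrow> 'z" where
  "tensor_lift sZ f t = lin_ext sZ (\<lambda>(v, w). f v w) (tensor_rep t)"

definition tensor_mult ::
    "('k::field \<Rightarrow> 'a \<Rightarrow> 'a::ring) \<Rightarrow> ('k \<Rightarrow> 'b \<Rightarrow> 'b::ring)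
     \<Rightarrow> ('a \<times> 'b \<Rightarrow>\<^sub>0 'k) set \<Rightarrow> ('a \<times> 'b \<Rightarrow>\<^sub>0 'k) set \<Rightarrow> ('a \<times> 'b \<Rightarrow>\<^sub>0 'k) set" where
  "tensor_mult sA sB s t = tensor_class sA sB
     (tensor_lift formal_scale
        (\<lambda>a b. tensor_lift formal_scale (\<lambda>c d. Poly_Mapping.single (a * c, b * d) 1) t) s)"


section \<open>Algebras, Hopf algebras and partial actions\<close>

text \<open>The sort \<open>{ring, monoid_mult}\<close> is used instead of \<open>ring_1\<close> so that the zero algebra is allowed.\<close>

locale unital_algebra = vector_space scale
  for scale :: "'k::field \<Rightarrow> 'a \<Rightarrow> 'a::{ring,monoid_mult}" +
  assumes scale_mult_left: "scale c a * b = scale c (a * b)"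
    and scale_mult_right: "a * scale c b = scale c (a * b)"

locale hopf_algebra = unital_algebra scale
  for scale :: "'k::field \<Rightarrow> 'h \<Rightarrow> 'h::{ring,monoid_mult}" +
  fixes \<Delta> :: "'h \<Rightarrow> ('h \<times> 'h \<Rightarrow>\<^sub>0 'k) set"
    and \<epsilon> :: "'h \<Rightarrow> 'k"
    and S :: "'h \<Rightarrow> 'h"
  assumes comult_in: "\<Delta> h \<in> tensor_space scale scale"
    and comult_add: "\<Delta> (h + k) = tensor_add scale scale (\<Delta> h) (\<Delta> k)"
    and comult_scale: "\<Delta> (scale c h) = tensor_scale scale scale c (\<Delta> h)"
    and counit_linear: "Vector_Spaces.linear scale (*) \<epsilon>"
    and coassoc:
      "tensor3_class scale scale scale
         (tensor_lift formal_scale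
            (\<lambda>a b. tensor_lift formal_scale (\<lambda>c d. Poly_Mapping.single (c, d, b) 1) (\<Delta> a)) (\<Delta> h))
       = tensor3_class scale scale scale
         (tensor_lift formal_scale
            (\<lambda>a b. tensor_lift formal_scale (\<lambda>c d. Poly_Mapping.single (a, c, d) 1) (\<Delta> b)) (\<Delta> h))"
    and counit_left: "tensor_lift scale (\<lambda>a b. scale (\<epsilon> a) b) (\<Delta> h) = h"
    and counit_right: "tensor_lift scale (\<lambda>a b. scale (\<epsilon> b) a) (\<Delta> h) = h"
    and comult_mult: "\<Delta> (h * k) = tensor_mult scale scale (\<Delta> h) (\<Delta> k)"
    and comult_one: "\<Delta> 1 = tensor scale scale 1 1"
    and counit_mult: "\<epsilon> (h * k) = \<epsilon> h * \<epsilon> k"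
    and counit_one: "\<epsilon> 1 = 1"
    and antipode_linear: "Vector_Spaces.linear scale scale S"
    and antipode_left: "tensor_lift scale (\<lambda>a b. S a * b) (\<Delta> h) = scale (\<epsilon> h) 1"
    and antipode_right: "tensor_lift scale (\<lambda>a b. a * S b) (\<Delta> h) = scale (\<epsilon> h) 1"

definition grouplikes ::
    "('k::field \<Rightarrow> 'h \<Rightarrow> 'h::ab_group_add) \<Rightarrow> ('h \<Rightarrow> ('h \<times> 'h \<Rightarrow>\<^sub>0 'k) set) \<Rightarrow> 'h set" where
  "grouplikes scale \<Delta> = {g. g \<noteq> 0 \<and> \<Delta> g = tensor scale scale g g}"

text \<open>A linear map on the tensor product of \<open>'h\<close> and \<open>'r\<close> is given as a bilinear map \<open>act\<close>.\<close>

locale partial_action =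
  H: hopf_algebra sH \<Delta> \<epsilon> S + R: unital_algebra sR
  for sH :: "'k::field \<Rightarrow> 'h \<Rightarrow> 'h::{ring,monoid_mult}"
    and \<Delta> :: "'h \<Rightarrow> ('h \<times> 'h \<Rightarrow>\<^sub>0 'k) set"
    and \<epsilon> :: "'h \<Rightarrow> 'k"
    and S :: "'h \<Rightarrow> 'h"
    and sR :: "'k \<Rightarrow> 'r \<Rightarrow> 'r::{ring,monoid_mult}" +
  fixes act :: "'h \<Rightarrow> 'r \<Rightarrow> 'r"
  assumes act_linear_left: "Vector_Spaces.linear sH sR (\<lambda>h. act h r)"
    and act_linear_right: "Vector_Spaces.linear sR sR (\<lambda>r. act h r)"
    and act_one: "act 1 r = r"
    and act_mult: "act h (r * s) = tensor_lift sR (\<lambda>h1 h2. act h1 r * act h2 s) (\<Delta> h)"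
    and act_act: "act h (act k r) = tensor_lift sR (\<lambda>h1 h2. act h1 1 * act (h2 * k) r) (\<Delta> h)"


section \<open>\<open>q\<close>-binomial coefficients\<close>

primrec qbinomial :: "'k::field \<Rightarrow> nat \<Rightarrow> int \<Rightarrow> 'k" where
  "qbinomial q 0 m = (if m = 0 then 1 else 0)"
| "qbinomial q (Suc n) m =
     (if 0 \<le> m \<and> m \<le> int (Suc n)
      then qbinomial q n m + q ^ nat (int (Suc n) - m) * qbinomial q n (m - 1)
      else 0)"


section \<open>Independence of representatives\<close>

lemma lookup_formal_scale [simp]:
  "Poly_Mapping.lookup (formal_scale c u) p = c * Poly_Mapping.lookup u p"
  unfolding formal_scale_def by (simp add: Poly_Mapping.map.rep_eq when_def)

lemma vector_space_formal_scale: "vector_space formal_scale"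
  by unfold_locales (auto intro!: poly_mapping_eqI simp: lookup_add algebra_simps)

lemma lin_ext_superset:
  assumes "vector_space sZ" "finite A" "Poly_Mapping.keys u \<subseteq> A"
  shows "lin_ext sZ f u = (\<Sum>p\<in>A. sZ (Poly_Mapping.lookup u p) (f p))"
proof -
  interpret vector_space sZ by fact
  show ?thesis unfolding lin_ext_def
    by (rule sum.mono_neutral_left) (use assms in \<open>auto simp: in_keys_iff\<close>)
qed

lemma linear_lin_ext:
  assumes "vector_space sZ"
  shows "Vector_Spaces.linear formal_scale sZ (lin_ext sZ f)"
proof -
  interpret Z: vector_space sZ by fact
  interpret F: vector_space formal_scale by (rule vector_space_formal_scale)
  have "lin_ext sZ f (u + v) = lin_ext sZ f u + lin_ext sZ f v" for u v
  proof -
    let ?A = "Poly_Mapping.keys u \<union> Poly_Mapping.keys v"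
    have "Poly_Mapping.keys (u + v) \<subseteq> ?A" by (rule Poly_Mapping.keys_add)
    then show ?thesis
      by (simp add: lin_ext_superset[OF assms, of ?A] lookup_add Z.scale_left_distrib sum.distrib)
  qed
  moreover have "lin_ext sZ f (formal_scale c u) = sZ c (lin_ext sZ f u)" for c u
  proof -
    have "Poly_Mapping.keys (formal_scale c u) \<subseteq> Poly_Mapping.keys u"
      by (auto simp: in_keys_iff)
    then show ?thesis
      by (simp add: lin_ext_superset[OF assms, of "Poly_Mapping.keys u"] Z.scale_sum_right)
  qed
  ultimately show ?thesis
    by (intro_locales; unfold_locales) auto
qed

lemma lin_ext_single:
  assumes "vector_space sZ"
  shows "lin_ext sZ f (Poly_Mapping.single p c) = sZ c (f p)"
proof -
  interpret vector_space sZ by fact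
  show ?thesis by (simp add: lin_ext_superset[OF assms, of "{p}"])
qed

lemma equiv_tensor_rel: "equiv UNIV (tensor_rel sV sW)"
proof -
  interpret F: vector_space formal_scale by (rule vector_space_formal_scale)
  show ?thesis
  proof (rule equivI)
    show "refl (tensor_rel sV sW)"
      by (simp add: refl_on_def tensor_rel_def tensor_null_def F.span_zero)
    show "sym (tensor_rel sV sW)"
    proof (rule symI)
      fix s t assume "(s, t) \<in> tensor_rel sV sW"
      then have "- (s - t) \<in> tensor_null sV sW"
        unfolding tensor_rel_def tensor_null_def by (intro F.span_neg) simp
      then show "(t, s) \<in> tensor_rel sV sW" by (simp add: tensor_rel_def)
    qed
    show "trans (tensor_rel sV sW)"
    proof (rule transI)
      fix s t u assume "(s, t) \<in> tensor_rel sV sW" "(t, u) \<in> tensor_rel sV sW"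
      then have "(s - t) + (t - u) \<in> tensor_null sV sW"
        unfolding tensor_rel_def tensor_null_def by (intro F.span_add) simp_all
      then show "(s, u) \<in> tensor_rel sV sW" by (simp add: tensor_rel_def)
    qed
  qed simp
qed

lemma tensor_class_eqI:
  "(u, v) \<in> tensor_rel sV sW \<Longrightarrow> tensor_class sV sW u = tensor_class sV sW v"
  unfolding tensor_class_def by (rule equiv_class_eq[OF equiv_tensor_rel])

lemma tensor_rep_class: "(u, tensor_rep (tensor_class sV sW u)) \<in> tensor_rel sV sW"
proof -
  have "u \<in> tensor_class sV sW u"
    unfolding tensor_class_def using equiv_tensor_rel by (rule equiv_class_self) simp
  then have "tensor_rep (tensor_class sV sW u) \<in> tensor_class sV sW u"
    unfolding tensor_rep_def by (rule someI)
  then show ?thesis by (simp add: tensor_class_def)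
qed

lemma tensor_lift_class:
  assumes "\<And>w. Vector_Spaces.linear sV sZ (\<lambda>v. f v w)" "\<And>v. Vector_Spaces.linear sW sZ (f v)"
  shows "tensor_lift sZ f (tensor_class sV sW u) = lin_ext sZ (\<lambda>(v, w). f v w) u"
proof -
  interpret V: vector_space_pair sV sZ
    using assms(1)[of undefined] by (simp add: vector_space_pair_def Vector_Spaces.linear_def)
  interpret W: vector_space_pair sW sZ
    using assms(2)[of undefined] by (simp add: vector_space_pair_def Vector_Spaces.linear_def)
  have Z: "vector_space sZ" ..
  let ?L = "lin_ext sZ (\<lambda>(v, w). f v w)"
  interpret L: Vector_Spaces.linear formal_scale sZ ?L
    by (rule linear_lin_ext[OF Z])
  have "?L n = 0" if "n \<in> tensor_null sV sW" for n
    using that unfolding tensor_null_def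
  proof (induction rule: L.vs1.span_induct)
    case base
    show ?case by (auto simp: L.vs1.subspace_def L.add L.scale)
  next
    case (step n)
    then show ?case
      by (auto simp: slot_relations_def L.diff lin_ext_single[OF Z]
          V.linear_add[OF assms(1)] V.linear_scale[OF assms(1)]
          W.linear_add[OF assms(2)] W.linear_scale[OF assms(2)])
  qed
  then have "?L (u - tensor_rep (tensor_class sV sW u)) = 0"
    using tensor_rep_class[of u sV sW] by (simp add: tensor_rel_def)
  then show ?thesis by (simp add: tensor_lift_def L.diff)
qed

lemma tensor_add_class:
  "tensor_add sV sW (tensor_class sV sW u) (tensor_class sV sW v) = tensor_class sV sW (u + v)"
proof -
  interpret F: vector_space formal_scale by (rule vector_space_formal_scale)
  let ?u = "tensor_rep (tensor_class sV sW u)" and ?v = "tensor_rep (tensor_class sV sW v)"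
  have "(u - ?u) + (v - ?v) \<in> tensor_null sV sW"
    using tensor_rep_class[of u sV sW] tensor_rep_class[of v sV sW]
    by (auto simp: tensor_rel_def tensor_null_def intro!: F.span_add)
  then have "(u + v, ?u + ?v) \<in> tensor_rel sV sW"
    by (simp add: tensor_rel_def algebra_simps)
  then show ?thesis
    unfolding tensor_add_def
    by (rule tensor_class_eqI[symmetric])
qed

lemma tensor_scale_class:
  "tensor_scale sV sW c (tensor_class sV sW u) = tensor_class sV sW (formal_scale c u)"
proof -
  interpret F: vector_space formal_scale by (rule vector_space_formal_scale)
  let ?u = "tensor_rep (tensor_class sV sW u)"
  have "formal_scale c (u - ?u) \<in> tensor_null sV sW"
    using tensor_rep_class[of u sV sW]
    by (auto simp: tensor_rel_def tensor_null_def intro!: F.span_scale)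
  then have "(formal_scale c u, formal_scale c ?u) \<in> tensor_rel sV sW"
    by (simp add: tensor_rel_def F.scale_right_diff_distrib)
  then show ?thesis
    unfolding tensor_scale_def
    by (rule tensor_class_eqI[symmetric])
qed

lemma tensor_lift_class_mod:
  assumes Z: "vector_space sZ" and N: "module.subspace sZ N"
    and add1: "\<And>a b w. f (a + b) w - f a w - f b w \<in> N"
    and scale1: "\<And>c a w. f (sV c a) w - sZ c (f a w) \<in> N"
    and add2: "\<And>v a b. f v (a + b) - f v a - f v b \<in> N"
    and scale2: "\<And>c v a. f v (sW c a) - sZ c (f v a) \<in> N"
  shows "lin_ext sZ (\<lambda>(v, w). f v w) u - tensor_lift sZ f (tensor_class sV sW u) \<in> N"
proof -
  let ?L = "lin_ext sZ (\<lambda>(v, w). f v w)"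
  interpret L: Vector_Spaces.linear formal_scale sZ ?L
    by (rule linear_lin_ext[OF Z])
  have "?L n \<in> N" if "n \<in> tensor_null sV sW" for n
    using that unfolding tensor_null_def
  proof (induction rule: L.vs1.span_induct)
    case base
    show ?case using N by (auto simp: L.vs1.subspace_def L.vs2.subspace_def L.add L.scale)
  next
    case (step n)
    then show ?case
      using add1 scale1 add2 scale2
      by (auto simp: slot_relations_def L.diff lin_ext_single[OF Z])
  qed
  then have "?L (u - tensor_rep (tensor_class sV sW u)) \<in> N"
    using tensor_rep_class[of u sV sW] by (simp add: tensor_rel_def)
  then show ?thesis by (simp add: tensor_lift_def L.diff)
qed

lemma tensor_mult_class:
  fixes sA :: "'k::field \<Rightarrow> 'a \<Rightarrow> 'a::{ring,monoid_mult}"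
    and sB :: "'k \<Rightarrow> 'b \<Rightarrow> 'b::{ring,monoid_mult}"
  assumes A: "unital_algebra sA" and B: "unital_algebra sB"
  shows "tensor_mult sA sB (tensor_class sA sB u) (tensor_class sA sB v) =
    tensor_class sA sB
      (lin_ext formal_scale (\<lambda>(a, b). lin_ext formal_scale
         (\<lambda>(c, d). Poly_Mapping.single (a * c, b * d) 1) v) u)"
proof -
  interpret A: unital_algebra sA by fact
  interpret B: unital_algebra sB by fact
  interpret F: vector_space formal_scale by (rule vector_space_formal_scale)
  let ?N = "tensor_null sA sB"
  let ?p = "\<lambda>a b. Poly_Mapping.single (a, b) (1::'k)"
  have sub: "F.subspace ?N" unfolding tensor_null_def by (rule F.subspace_span)
  have rel: "?p (a + a') b - ?p a b - ?p a' b \<in> ?N" "?p a (b + b') - ?p a b - ?p a b' \<in> ?N"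
    "?p (sA c a) b - formal_scale c (?p a b) \<in> ?N" "?p a (sB c b) - formal_scale c (?p a b) \<in> ?N"
    for a a' b b' c
  proof -
    have [simp]: "formal_scale c (?p a b) = Poly_Mapping.single (a, b) c" for a b
      by (rule poly_mapping_eqI) (simp add: lookup_single when_def)
    show "?p (a + a') b - ?p a b - ?p a' b \<in> ?N" "?p a (b + b') - ?p a b - ?p a b' \<in> ?N"
    "?p (sA c a) b - formal_scale c (?p a b) \<in> ?N" "?p a (sB c b) - formal_scale c (?p a b) \<in> ?N"
      unfolding tensor_null_def by (rule F.span_base; fastforce simp: slot_relations_def)+
  qed
  define G :: "('a \<times> 'b \<Rightarrow>\<^sub>0 'k) \<Rightarrow> 'a \<Rightarrow> 'b \<Rightarrow> 'a \<times> 'b \<Rightarrow>\<^sub>0 'k"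
    where "G w a b = lin_ext formal_scale (\<lambda>(c, d). ?p (a * c) (b * d)) w" for w a b
  have sumN: "(\<Sum>p\<in>K. formal_scale (l p) (h p)) \<in> ?N" if "\<And>p. h p \<in> ?N"
    for K l and h :: "'a \<times> 'b \<Rightarrow> 'a \<times> 'b \<Rightarrow>\<^sub>0 'k"
    by (rule F.subspace_sum[OF sub]) (rule F.subspace_scale[OF sub that])
  have G_add1: "G w (a + a') b - G w a b - G w a' b \<in> ?N" for w a a' b
  proof -
    have "G w (a + a') b - G w a b - G w a' b = lin_ext formal_scale
        (\<lambda>(c, d). ?p ((a + a') * c) (b * d) - ?p (a * c) (b * d) - ?p (a' * c) (b * d)) w"
      by (simp add: G_def lin_ext_def sum_subtractf F.scale_right_diff_distrib case_prod_beta)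
    also have "\<dots> \<in> ?N"
      unfolding lin_ext_def by (rule sumN) (auto simp: distrib_right intro: rel)
    finally show ?thesis .
  qed
  have G_add2: "G w a (b + b') - G w a b - G w a b' \<in> ?N" for w a b b'
  proof -
    have "G w a (b + b') - G w a b - G w a b' = lin_ext formal_scale
        (\<lambda>(c, d). ?p (a * c) ((b + b') * d) - ?p (a * c) (b * d) - ?p (a * c) (b' * d)) w"
      by (simp add: G_def lin_ext_def sum_subtractf F.scale_right_diff_distrib case_prod_beta)
    also have "\<dots> \<in> ?N"
      unfolding lin_ext_def by (rule sumN) (auto simp: distrib_right intro: rel)
    finally show ?thesis .
  qed
  have G_scale1: "G w (sA c a) b - formal_scale c (G w a b) \<in> ?N" for w a b c
  proof -
    have "G w (sA c a) b - formal_scale c (G w a b) = lin_ext formal_scale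
        (\<lambda>(x, y). ?p (sA c a * x) (b * y) - formal_scale c (?p (a * x) (b * y))) w"
      by (simp add: G_def lin_ext_def sum_subtractf F.scale_right_diff_distrib case_prod_beta
          F.scale_sum_right mult.commute)
    also have "\<dots> \<in> ?N"
      unfolding lin_ext_def by (rule sumN) (auto simp: A.scale_mult_left simp del: F.scale_scale intro: rel)
    finally show ?thesis .
  qed
  have G_scale2: "G w a (sB c b) - formal_scale c (G w a b) \<in> ?N" for w a b c
  proof -
    have "G w a (sB c b) - formal_scale c (G w a b) = lin_ext formal_scale
        (\<lambda>(x, y). ?p (a * x) (sB c b * y) - formal_scale c (?p (a * x) (b * y))) w"
      by (simp add: G_def lin_ext_def sum_subtractf F.scale_right_diff_distrib case_prod_beta
          F.scale_sum_right mult.commute)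
    also have "\<dots> \<in> ?N"
      unfolding lin_ext_def by (rule sumN) (auto simp: B.scale_mult_left simp del: F.scale_scale intro: rel)
    finally show ?thesis .
  qed
  let ?v = "tensor_rep (tensor_class sA sB v)"
  have inner: "G v a b - G ?v a b \<in> ?N" for a b
    using tensor_lift_class_mod[OF vector_space_formal_scale sub,
        of "\<lambda>c d. ?p (a * c) (b * d)" sA sB v] rel
    by (simp add: G_def tensor_lift_def distrib_left A.scale_mult_right B.scale_mult_right)
  have "lin_ext formal_scale (\<lambda>(a, b). G v a b) u - lin_ext formal_scale (\<lambda>(a, b). G ?v a b) u \<in> ?N"
  proof -
    have "lin_ext formal_scale (\<lambda>(a, b). G v a b) u - lin_ext formal_scale (\<lambda>(a, b). G ?v a b) u
        = lin_ext formal_scale (\<lambda>(a, b). G v a b - G ?v a b) u"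
      by (simp add: lin_ext_def sum_subtractf F.scale_right_diff_distrib case_prod_beta)
    also have "\<dots> \<in> ?N"
      unfolding lin_ext_def by (rule sumN) (auto intro: inner)
    finally show ?thesis .
  qed
  moreover have "lin_ext formal_scale (\<lambda>(a, b). G ?v a b) u
      - tensor_lift formal_scale (G ?v) (tensor_class sA sB u) \<in> ?N"
    by (rule tensor_lift_class_mod[OF vector_space_formal_scale sub])
      (rule G_add1 G_scale1 G_add2 G_scale2)+
  ultimately have "lin_ext formal_scale (\<lambda>(a, b). G v a b) u
      - tensor_lift formal_scale (G ?v) (tensor_class sA sB u) \<in> ?N"
    using F.subspace_add[OF sub] by force
  then have "(lin_ext formal_scale (\<lambda>(a, b). G v a b) u,
      tensor_lift formal_scale (G ?v) (tensor_class sA sB u)) \<in> tensor_rel sA sB"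
    by (simp add: tensor_rel_def)
  then have "tensor_class sA sB (tensor_lift formal_scale (G ?v) (tensor_class sA sB u))
      = tensor_class sA sB (lin_ext formal_scale (\<lambda>(a, b). G v a b) u)"
    by (rule tensor_class_eqI[symmetric])
  then show ?thesis
    by (simp add: tensor_mult_def G_def tensor_lift_def)
qed

end

theory Submission
  imports Defs
begin

text \<open>
  Write \<open>X = x \<cdot> 1\<close> and \<open>p = q\<^sup>-\<^sup>1\<close>.  The whole theorem is the case \<open>j = 1\<close>,
  \<open>x a \<cdot> r = X (a \<cdot> r) - (g a \<cdot> r) X\<close> (\<open>act_skew_primitive_mult\<close>), iterated.
  Replacing \<open>a\<close> by \<open>x\<^sup>j g\<^sup>m a\<close> and using \<open>g x\<^sup>j = p\<^sup>j x\<^sup>j g\<close>, this rule becomes a recurrence in \<open>j\<close>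
  and \<open>m\<close> (\<open>act_power_step\<close>) whose solution has the stated coefficients, because their recurrence is the
  \<open>p\<close>-Pascal rule that defines the Gaussian binomial coefficients (\<open>skew_commutator_coeff_Suc\<close>,
  \<open>iterated_skew_commutator\<close>).

  For the case \<open>j = 1\<close>, the axioms evaluated at \<open>x\<close> only give \<open>x \<cdot> s = X s\<close>: the factor \<open>g \<cdot> 1 = 0\<close>
  kills the very term in which the product \<open>x a\<close> acts.  The element \<open>g\<^sup>-\<^sup>1 x\<close> works instead, since its
  coproduct \<open>g\<^sup>-\<^sup>1 x \<otimes> g\<^sup>-\<^sup>1 + 1 \<otimes> g\<^sup>-\<^sup>1 x\<close> contains \<open>1\<close> where that of \<open>x\<close> contains \<open>g\<close>.
  Put \<open>y = g\<^sup>-\<^sup>1 x \<cdot> 1\<close>.  As \<open>g\<^sup>-\<^sup>1 \<cdot> 1 = 0\<close> as well, the second axiom gives \<open>g\<^sup>-\<^sup>1 x \<cdot> s = s y\<close>, while the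
  third one gives \<open>g\<^sup>-\<^sup>1 x \<cdot> (g a \<cdot> r) = y (a \<cdot> r) + q (x a \<cdot> r)\<close>.  Comparing the two,
  \<open>(g a \<cdot> r) y = y (a \<cdot> r) + q (x a \<cdot> r)\<close>.  At \<open>a = 1\<close> and \<open>r = 1\<close> the left-hand side vanishes, hence
  \<open>y = - q X\<close>; inserting this and dividing by \<open>q\<close> gives the case \<open>j = 1\<close>.

  The inverse of \<open>g\<close> is \<open>S g\<close>.  Its coproduct, and that of \<open>g\<^sup>-\<^sup>1 x\<close>, are used only through the values
  of bilinear maps on them; \<open>sweedler_mult\<close> makes these computable without developing the
  algebra structure of the tensor product.
\<close>

section \<open>Bilinear maps and Sweedler notation\<close>

definition bilinear_map ::
    "('k::field \<Rightarrow> 'v \<Rightarrow> 'v::ab_group_add) \<Rightarrow> ('k \<Rightarrow> 'w \<Rightarrow> 'w::ab_group_add)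
     \<Rightarrow> ('k \<Rightarrow> 'z \<Rightarrow> 'z::ab_group_add) \<Rightarrow> ('v \<Rightarrow> 'w \<Rightarrow> 'z) \<Rightarrow> bool" where
  "bilinear_map sV sW sZ f \<longleftrightarrow>
     (\<forall>w. Vector_Spaces.linear sV sZ (\<lambda>v. f v w)) \<and> (\<forall>v. Vector_Spaces.linear sW sZ (f v))"

lemma bilinear_map_vector_space:
  assumes "bilinear_map sV sW sZ f"
  shows "vector_space sZ"
  using assms by (auto simp: bilinear_map_def Vector_Spaces.linear_def)

lemma bilinear_map_add:
  assumes "bilinear_map sV sW sZ f" "bilinear_map sV sW sZ f'"
  shows "bilinear_map sV sW sZ (\<lambda>v w. f v w + f' v w)"
  using assms unfolding bilinear_map_def
  by (auto simp: Vector_Spaces.linear_iff vector_space.vector_space_assms algebra_simps)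

lemma tensor_lift_bilinear:
  assumes "bilinear_map sV sW sZ f"
  shows "tensor_lift sZ f (tensor_class sV sW u) = lin_ext sZ (\<lambda>(v, w). f v w) u"
  using assms by (intro tensor_lift_class) (auto simp: bilinear_map_def)

lemma tensor_lift_tensor:
  assumes "bilinear_map sV sW sZ f"
  shows "tensor_lift sZ f (tensor sV sW v w) = f v w"
proof -
  interpret vector_space sZ by (rule bilinear_map_vector_space[OF assms])
  show ?thesis
    by (simp add: tensor_def tensor_lift_bilinear[OF assms] lin_ext_single vector_space_axioms)
qed

lemma tensor_lift_tensor_add:
  assumes "bilinear_map sV sW sZ f"
  shows "tensor_lift sZ f (tensor_add sV sW (tensor sV sW v w) (tensor sV sW v' w'))
    = f v w + f v' w'"
proof -
  interpret vector_space sZ by (rule bilinear_map_vector_space[OF assms])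
  interpret L: Vector_Spaces.linear formal_scale sZ "lin_ext sZ (\<lambda>(v, w). f v w)"
    by (rule linear_lin_ext) (rule vector_space_axioms)
  show ?thesis
    by (simp add: tensor_def tensor_add_class tensor_lift_bilinear[OF assms] L.add
        lin_ext_single vector_space_axioms)
qed

lemma lin_ext_lin_ext:
  assumes "vector_space sZ"
  shows "lin_ext sZ f (lin_ext formal_scale G u) = lin_ext sZ (\<lambda>p. lin_ext sZ f (G p)) u"
proof -
  interpret L: Vector_Spaces.linear formal_scale sZ "lin_ext sZ f"
    by (rule linear_lin_ext) fact
  show ?thesis unfolding lin_ext_def[of formal_scale] lin_ext_def[of sZ _ u]
    by (simp add: L.sum L.scale)
qed

context unital_algebra
begin

lemma linear_mult_left: "Vector_Spaces.linear scale scale (\<lambda>h. h * k)"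
  by (intro_locales; unfold_locales) (auto simp: distrib_right scale_mult_left)

lemma linear_mult_right: "Vector_Spaces.linear scale scale (\<lambda>h. k * h)"
  by (intro_locales; unfold_locales) (auto simp: distrib_left scale_mult_right)

lemma bilinear_map_mult_compose:
  assumes "Vector_Spaces.linear sV scale F" "Vector_Spaces.linear sW scale G"
  shows "bilinear_map sV sW scale (\<lambda>v w. F v * G w)"
  using Vector_Spaces.linear_compose[OF assms(1) linear_mult_left]
    Vector_Spaces.linear_compose[OF assms(2) linear_mult_right]
  by (auto simp: bilinear_map_def o_def)

lemma bilinear_map_compose_mult:
  assumes "bilinear_map scale scale sZ f"
  shows "bilinear_map scale scale sZ (\<lambda>h k. f (b * h) (c * k))"
    and "bilinear_map scale scale sZ (\<lambda>h k. f (h * b) (k * c))"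
proof -
  have f: "Vector_Spaces.linear scale sZ (\<lambda>h. f h k)" "Vector_Spaces.linear scale sZ (f h)" for h k
    using assms by (auto simp: bilinear_map_def)
  show "bilinear_map scale scale sZ (\<lambda>h k. f (b * h) (c * k))"
    using Vector_Spaces.linear_compose[OF linear_mult_right f(1)]
      Vector_Spaces.linear_compose[OF linear_mult_right f(2)]
    by (simp add: bilinear_map_def o_def)
  show "bilinear_map scale scale sZ (\<lambda>h k. f (h * b) (k * c))"
    using Vector_Spaces.linear_compose[OF linear_mult_left f(1)]
      Vector_Spaces.linear_compose[OF linear_mult_left f(2)]
    by (simp add: bilinear_map_def o_def)
qed

end

section \<open>Grouplike and skew-primitive elements\<close>

context hopf_algebra
begin

text \<open>
  Once bilinearity of \<open>f\<close> has removed the representative of \<open>\<Delta> (h k)\<close>, both sides use the same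
  chosen representatives of \<open>\<Delta> h\<close> and \<open>\<Delta> k\<close>, and the equation reduces to the composition of linear
  extensions.  In Sweedler notation it reads \<open>f ((h k)\<^sub>1, (h k)\<^sub>2) = f (h\<^sub>1 k\<^sub>1, h\<^sub>2 k\<^sub>2)\<close>.
\<close>

lemma sweedler_mult:
  assumes "bilinear_map scale scale sZ f"
  shows "tensor_lift sZ f (\<Delta> (h * k)) =
    tensor_lift sZ (\<lambda>a b. tensor_lift sZ (\<lambda>c d. f (a * c) (b * d)) (\<Delta> k)) (\<Delta> h)"
proof -
  have Z: "vector_space sZ" by (rule bilinear_map_vector_space[OF assms])
  show ?thesis
    unfolding comult_mult tensor_mult_def tensor_lift_bilinear[OF assms]
    by (simp add: tensor_lift_def lin_ext_lin_ext[OF Z] lin_ext_single[OF Z]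
        vector_space.vector_space_assms(4)[OF Z] case_prod_beta')
qed

lemma sweedler_one:
  assumes "bilinear_map scale scale sZ f"
  shows "tensor_lift sZ f (\<Delta> 1) = f 1 1"
  by (simp add: comult_one tensor_lift_tensor[OF assms])

lemma sweedler_grouplike:
  assumes "g \<in> grouplikes scale \<Delta>" "bilinear_map scale scale sZ f"
  shows "tensor_lift sZ f (\<Delta> g) = f g g"
  using assms(1) by (simp add: grouplikes_def tensor_lift_tensor[OF assms(2)])

lemma counit_grouplike:
  assumes "g \<in> grouplikes scale \<Delta>"
  shows "\<epsilon> g = 1"
proof -
  have "Vector_Spaces.linear scale scale (\<lambda>h. scale (\<epsilon> h) b)" for b
    using counit_linear
    by (simp add: Vector_Spaces.linear_iff scale_left_distrib vector_space_axioms)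
  moreover have "Vector_Spaces.linear scale scale (scale c)" for c
    by (simp add: linear_scale_self)
  ultimately have "bilinear_map scale scale scale (\<lambda>h k. scale (\<epsilon> h) k)"
    by (auto simp: bilinear_map_def)
  from sweedler_grouplike[OF assms this] have "scale (\<epsilon> g) g = scale 1 g"
    using counit_left[of g] by simp
  then show ?thesis
    using assms unfolding grouplikes_def scale_cancel_right by simp
qed

lemma antipode_grouplike:
  assumes "g \<in> grouplikes scale \<Delta>"
  shows "S g * g = 1" "g * S g = 1"
proof -
  have id: "Vector_Spaces.linear scale scale (\<lambda>h. h)"
    by (rule linear_ident)
  show "S g * g = 1"
    using antipode_left[of g] counit_grouplike[OF assms]
      sweedler_grouplike[OF assms bilinear_map_mult_compose[OF antipode_linear id]] by simp
  show "g * S g = 1"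
    using antipode_right[of g] counit_grouplike[OF assms]
      sweedler_grouplike[OF assms bilinear_map_mult_compose[OF id antipode_linear]] by simp
qed

text \<open>
  That \<open>S g = g\<^sup>-\<^sup>1\<close> is grouplike follows by writing
  \<open>f(h\<^sub>1, h\<^sub>2) = f(h\<^sub>1 g g\<^sup>-\<^sup>1, h\<^sub>2 g g\<^sup>-\<^sup>1)\<close> and collecting \<open>h\<^sub>1 g \<otimes> h\<^sub>2 g\<close> into the coproduct of
  \<open>h g = 1\<close>, where \<open>h = g\<^sup>-\<^sup>1\<close>.
\<close>

lemma sweedler_antipode_grouplike:
  assumes g: "g \<in> grouplikes scale \<Delta>" and f: "bilinear_map scale scale sZ f"
  shows "tensor_lift sZ f (\<Delta> (S g)) = f (S g) (S g)"
proof -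
  let ?f = "\<lambda>h k. f (h * S g) (k * S g)"
  note f' = bilinear_map_compose_mult(2)[OF f, of "S g" "S g"]
  have "tensor_lift sZ ?f (\<Delta> (S g * g))
      = tensor_lift sZ (\<lambda>a b. tensor_lift sZ (\<lambda>c d. ?f (a * c) (b * d)) (\<Delta> g)) (\<Delta> (S g))"
    by (rule sweedler_mult[OF f'])
  also have "\<dots> = tensor_lift sZ f (\<Delta> (S g))"
    by (simp only: sweedler_grouplike[OF g bilinear_map_compose_mult(1)[OF f']])
      (simp add: mult.assoc antipode_grouplike[OF g])
  finally show ?thesis
    by (simp add: antipode_grouplike[OF g] sweedler_one[OF f'])
qed

lemma sweedler_skew_primitive:
  assumes "\<Delta> x = tensor_add scale scale (tensor scale scale x 1) (tensor scale scale g x)"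
    and "bilinear_map scale scale sZ f"
  shows "tensor_lift sZ f (\<Delta> x) = f x 1 + f g x"
  by (simp add: assms(1) tensor_lift_tensor_add[OF assms(2)])

text \<open>
  Multiplying \<open>\<Delta> x\<close> by \<open>g\<^sup>-\<^sup>1 \<otimes> g\<^sup>-\<^sup>1\<close> turns the left factor \<open>g\<close> of its second term into \<open>1\<close>, which
  acts as the identity; this is why \<open>g\<^sup>-\<^sup>1 x\<close> is considered instead of \<open>x\<close>.
\<close>

lemma sweedler_antipode_mult_skew_primitive:
  assumes g: "g \<in> grouplikes scale \<Delta>"
    and x: "\<Delta> x = tensor_add scale scale (tensor scale scale x 1) (tensor scale scale g x)"
    and f: "bilinear_map scale scale sZ f"
  shows "tensor_lift sZ f (\<Delta> (S g * x)) = f (S g * x) (S g) + f 1 (S g * x)"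
proof -
  have "tensor_lift sZ f (\<Delta> (S g * x))
      = tensor_lift sZ (\<lambda>a b. f (a * x) (b * 1) + f (a * g) (b * x)) (\<Delta> (S g))"
    by (simp only: sweedler_mult[OF f]
        sweedler_skew_primitive[OF x bilinear_map_compose_mult(1)[OF f]])
  also have "\<dots> = f (S g * x) (S g * 1) + f (S g * g) (S g * x)"
    by (intro sweedler_antipode_grouplike g bilinear_map_add bilinear_map_compose_mult(2) f)
  finally show ?thesis
    by (simp add: antipode_grouplike[OF g])
qed

end

section \<open>The action of a skew-primitive element\<close>

context partial_action
begin

lemma bilinear_map_act_mult: "bilinear_map sH sH sR (\<lambda>h k. act h r * act k s)"
  by (rule R.bilinear_map_mult_compose) (rule act_linear_left)+

lemma bilinear_map_act_act: "bilinear_map sH sH sR (\<lambda>h k. act h r * act (k * b) s)"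
  using Vector_Spaces.linear_compose[OF H.linear_mult_left act_linear_left]
  by (intro R.bilinear_map_mult_compose act_linear_left) (simp add: o_def)

lemma act_scale_left: "act (sH c h) r = sR c (act h r)"
  using act_linear_left by (simp add: Vector_Spaces.linear_iff)

lemma act_zero_right: "act h 0 = 0"
proof -
  interpret L: Vector_Spaces.linear sR sR "\<lambda>r. act h r"
    by (rule act_linear_right)
  show ?thesis by (rule L.zero)
qed

text \<open>The third axiom expresses \<open>0 = g\<^sup>-\<^sup>1 \<cdot> (g \<cdot> 1)\<close> as \<open>(g\<^sup>-\<^sup>1 \<cdot> 1) (g\<^sup>-\<^sup>1 g \<cdot> 1)\<close>.\<close>

lemma act_antipode_grouplike_one:
  assumes g: "g \<in> grouplikes sH \<Delta>" and g1: "act g 1 = 0"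
  shows "act (S g) 1 = 0"
  using act_act[of "S g" g 1]
  by (simp add: H.sweedler_antipode_grouplike[OF g bilinear_map_act_act]
      H.antipode_grouplike[OF g] act_one g1 act_zero_right)

text \<open>
  Since \<open>g\<^sup>-\<^sup>1 \<cdot> 1 = 0\<close>, the element \<open>g\<^sup>-\<^sup>1 x\<close> acts as right multiplication by \<open>g\<^sup>-\<^sup>1 x \<cdot> 1\<close>.
  Letting it act on \<open>g a \<cdot> r\<close> brings in \<open>x a \<cdot> r\<close>, because \<open>g\<^sup>-\<^sup>1 x g = q x\<close>.
\<close>

lemma act_skew_primitive_mult:
  assumes g: "g \<in> grouplikes sH \<Delta>" and g1: "act g 1 = 0"
    and x: "\<Delta> x = tensor_add sH sH (tensor sH sH x 1) (tensor sH sH g x)"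
    and q: "q \<noteq> 0" and gx: "g * x = sH (inverse q) (x * g)"
  shows "act (x * a) r = act x 1 * act a r - act (g * a) r * act x 1"
proof -
  define y where "y = act (S g * x) 1"
  note sweedler = H.sweedler_antipode_mult_skew_primitive[OF g x]
  have "x * g = sH q (g * x)"
    by (simp add: gx q)
  then have conj: "S g * x * g = sH q x"
    by (simp add: mult.assoc H.scale_mult_right)
      (simp add: mult.assoc[symmetric] H.antipode_grouplike[OF g])
  have mult_y: "act (S g * x) s = s * y" for s
    using act_mult[of "S g * x" s 1]
    by (simp add: sweedler[OF bilinear_map_act_mult] act_antipode_grouplike_one[OF g g1]
        act_one y_def)
  have comm: "act (g * b) s * y = y * act b s + sR q (act (x * b) s)" for b s
  proof -
    have "S g * (g * b) = b" "S g * x * (g * b) = sH q (x * b)"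
      using conj by (simp_all add: mult.assoc[symmetric] H.antipode_grouplike[OF g]
          H.scale_mult_left)
    then show ?thesis
      using act_act[of "S g * x" "g * b" s]
      by (simp add: sweedler[OF bilinear_map_act_act] mult_y act_one act_scale_left
          flip: y_def)
  qed
  have "y = - sR q (act x 1)"
    using comm[of 1 1] by (simp add: g1 act_one eq_neg_iff_add_eq_0)
  then have "sR q (act (x * a) r) = sR q (act x 1 * act a r - act (g * a) r * act x 1)"
    using comm[of a r]
    by (simp add: R.scale_mult_left R.scale_mult_right R.scale_right_diff_distrib algebra_simps)
  then show ?thesis
    using q by simp
qed

end

section \<open>Iteration and the \<open>q\<close>-Pascal rule\<close>

lemma qbinomial_eq_0: "m < 0 \<or> int n < m \<Longrightarrow> qbinomial p n m = 0"
  by (cases n) auto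

definition skew_commutator_coeff :: "'k::field \<Rightarrow> nat \<Rightarrow> nat \<Rightarrow> 'k" where
  "skew_commutator_coeff q j k =
     (-1) ^ k * q powi (- (int k * (int k - 1) div 2)) * qbinomial (inverse q) j (int k)"

lemma skew_commutator_coeff_zero: "skew_commutator_coeff q (Suc j) 0 = skew_commutator_coeff q j 0"
  by (simp add: skew_commutator_coeff_def qbinomial_eq_0)

lemma skew_commutator_coeff_eq_0: "j < k \<Longrightarrow> skew_commutator_coeff q j k = 0"
  by (simp add: skew_commutator_coeff_def qbinomial_eq_0)

text \<open>
  The exponents match because \<open>k (k + 1) / 2 - k (k - 1) / 2 = k\<close>, which combines with the weight
  \<open>q\<^sup>-\<^sup>(\<^sup>j\<^sup>-\<^sup>k\<^sup>)\<close> of the Pascal rule to \<open>q\<^sup>-\<^sup>j\<close>.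
\<close>

lemma skew_commutator_coeff_Suc:
  assumes q: "q \<noteq> 0"
  shows "skew_commutator_coeff q (Suc j) (Suc k) =
    skew_commutator_coeff q j (Suc k) - inverse q ^ j * skew_commutator_coeff q j k"
proof (cases "k \<le> j")
  case True
  let ?t = "int k * (int k - 1) div 2"
  have "int (Suc k) * (int (Suc k) - 1) = int k * (int k - 1) + int k * 2"
    by (simp add: algebra_simps)
  then have "int (Suc k) * (int (Suc k) - 1) div 2 = ?t + int k"
    by simp
  then have tri: "q powi (- (int (Suc k) * (int (Suc k) - 1) div 2))
      = q powi (- ?t) * inverse q ^ k"
    using q by (simp add: power_int_diff power_int_minus field_simps)
  have "qbinomial (inverse q) (Suc j) (int (Suc k)) = qbinomial (inverse q) j (int (Suc k))
      + inverse q ^ (j - k) * qbinomial (inverse q) j (int k)"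
    using True by (simp add: nat_diff_distrib' flip: of_nat_diff)
  moreover have "inverse q ^ j = inverse q ^ k * inverse q ^ (j - k)"
    using True by (simp flip: power_add)
  ultimately show ?thesis
    unfolding skew_commutator_coeff_def tri by (simp only: power_Suc) (simp add: algebra_simps)
next
  case False
  then show ?thesis by (simp add: skew_commutator_coeff_eq_0)
qed

context unital_algebra
begin

text \<open>
  The second index of \<open>w\<close> records how far the base point has been shifted; the recurrence raises it,
  so the induction must be over all its values at once.
\<close>

lemma iterated_skew_commutator:
  assumes q: "q \<noteq> 0"
    and step: "\<And>j m. w (Suc j) m = X * w j m - scale (inverse q ^ j) (w j (Suc m) * X)"
  shows "w j m = (\<Sum>k=0..j. scale (skew_commutator_coeff q j k) (X ^ (j - k) * w 0 (m + k) * X ^ k))"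
proof (induction j arbitrary: m)
  case 0
  then show ?case by (simp add: skew_commutator_coeff_def)
next
  case (Suc j)
  let ?c = "skew_commutator_coeff q"
  let ?T = "\<lambda>k. X ^ (Suc j - k) * w 0 (m + k) * X ^ k"
  have "X * w j m = (\<Sum>k=0..j. scale (?c j k) (?T k))"
    by (auto simp: Suc.IH[of m] sum_distrib_left scale_mult_right Suc_diff_le mult.assoc
        intro!: sum.cong)
  also have "\<dots> = (\<Sum>k=0..Suc j. scale (?c j k) (?T k))"
    by (simp add: skew_commutator_coeff_eq_0)
  also have "\<dots> = scale (?c j 0) (?T 0) + (\<Sum>k=0..j. scale (?c j (Suc k)) (?T (Suc k)))"
    by (rule sum.atLeast0_atMost_Suc_shift[unfolded o_def])
  finally have left: "X * w j m = \<dots>" .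
  have right: "scale (inverse q ^ j) (w j (Suc m) * X)
      = (\<Sum>k=0..j. scale (inverse q ^ j * ?c j k) (?T (Suc k)))"
    by (auto simp: Suc.IH[of "Suc m"] sum_distrib_right scale_sum_right scale_mult_left mult.assoc
        power_commutes intro!: sum.cong)
  have "w (Suc j) m = scale (?c (Suc j) 0) (?T 0)
      + (\<Sum>k=0..j. scale (?c (Suc j) (Suc k)) (?T (Suc k)))"
    by (simp only: step left right skew_commutator_coeff_zero skew_commutator_coeff_Suc[OF q]
        scale_left_diff_distrib sum_subtractf add_diff_eq)
  also have "\<dots> = (\<Sum>k=0..Suc j. scale (?c (Suc j) k) (?T k))"
    by (rule sum.atLeast0_atMost_Suc_shift[unfolded o_def, symmetric])
  finally show ?case .
qed

lemma q_commute_power: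
  assumes "g * x = scale p (x * g)"
  shows "g * x ^ j = scale (p ^ j) (x ^ j * g)"
proof (induction j)
  case (Suc j)
  have "g * x ^ Suc j = scale p (x * (g * x ^ j))"
    by (simp add: mult.assoc[symmetric] assms scale_mult_left)
  then show ?case
    by (simp add: Suc scale_mult_right mult.assoc)
qed simp

end

context partial_action
begin

lemma act_power_step:
  assumes "g \<in> grouplikes sH \<Delta>" "act g 1 = 0"
    and "\<Delta> x = tensor_add sH sH (tensor sH sH x 1) (tensor sH sH g x)"
    and "q \<noteq> 0" and gx: "g * x = sH (inverse q) (x * g)"
  shows "act (x ^ Suc j * (g ^ m * a)) r = act x 1 * act (x ^ j * (g ^ m * a)) r
    - sR (inverse q ^ j) (act (x ^ j * (g ^ Suc m * a)) r * act x 1)"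
proof -
  have "g * (x ^ j * (g ^ m * a)) = sH (inverse q ^ j) (x ^ j * (g ^ Suc m * a))"
    by (simp add: mult.assoc[symmetric] H.q_commute_power[OF gx] H.scale_mult_left)
  then show ?thesis
    using act_skew_primitive_mult[OF assms, of "x ^ j * (g ^ m * a)" r]
    by (simp add: mult.assoc act_scale_left R.scale_mult_left)
qed

end

theorem theorem3p2:
  fixes sH :: "'k::{alg_closed_field,field_char_0} \<Rightarrow> 'h \<Rightarrow> 'h::{ring,monoid_mult}"
    and \<Delta> :: "'h \<Rightarrow> ('h \<times> 'h \<Rightarrow>\<^sub>0 'k) set"
    and \<epsilon> :: "'h \<Rightarrow> 'k"
    and S :: "'h \<Rightarrow> 'h"
    and sR :: "'k \<Rightarrow> 'r \<Rightarrow> 'r::{ring,monoid_mult}"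
    and act :: "'h \<Rightarrow> 'r \<Rightarrow> 'r"
    and g x a :: 'h and q :: 'k and r :: 'r and j :: nat
  assumes "partial_action sH \<Delta> \<epsilon> S sR act"
    and "g \<in> grouplikes sH \<Delta>"
    and "\<Delta> x = tensor_add sH sH (tensor sH sH x 1) (tensor sH sH g x)"
    and "q \<noteq> 0"
    and "g * x = sH (inverse q) (x * g)"
    and "act g 1 = 0"
  shows "act (x ^ j * a) r =
    (\<Sum>k=0..j. sR ((-1) ^ k * q powi (- (int k * (int k - 1) div 2))
                   * qbinomial (inverse q) j (int k))
                 (act x 1 ^ (j - k) * act (g ^ k * a) r * act x 1 ^ k))"
proof -
  interpret partial_action sH \<Delta> \<epsilon> S sR act by fact
  show ?thesis
    using R.iterated_skew_commutator[where w = "\<lambda>j m. act (x ^ j * (g ^ m * a)) r" and m = 0,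
        OF assms(4) act_power_step[OF assms(2,6,3,4,5)]]
    by (simp add: skew_commutator_coeff_def)
qed

end
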